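(* Let $\mathcal S^*=\mathcal S^*(\varphi_0)$ with $\varphi_0(z)=\dfrac{1+z}{1-z}$ be the full starlike class, and let $\varphi_{3/4}(z)=\dfrac{1-z/2}{1-z}$, $z\in\mathbb D$. Then $$R_{\mathcal S^*(\varphi_{3/4})}(\mathcal S^* )=\tfrac17.$$
   Context: Let $\mathbb D=\{z\in\mathbb C:|z|<1\}$ and let $\mathcal A$ be the class of functions $f$ analytic on $\mathbb D$ with $f(0)=0$ and $f'(0)=1$. For an analytic function $\varphi$ on $\mathbb D$ with $\varphi(0)=1$, the class $\mathcal S^*(\varphi)$ consists of all $f\in\mathcal A$ with $zf'(z)/f(z)\prec\varphi(z)$; that is, there is an analytic $\omega:\mathbb D\to\mathbb D$ with $\omega(0)=0$ such that $zf'(z)/f(z)=\varphi(\omega(z))$ on $\mathbb D$ (the quotient takes the value $1$ at $z=0$, and $f$ has no other zeros). For two such functions $\varphi_1,\varphi_2$, the sharp $\mathcal S^*(\varphi_2)$-radius of $\mathcal S^*(\varphi_1)$ is $$R_{\mathcal S^*(\varphi_2)}(\mathcal S^*(\varphi_1))=\sup\left\{r\in(0,1]: f_r(z)=\tfrac{f(rz)}{r}\text{ belongs to }\mathcal S^*(\varphi_2)\text{ for every } f\in\mathcal S^*(\varphi_1)\right\}.$$ *)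

theory Defs
  imports "HOL-Complex_Analysis.Complex_Analysis"
begin

text \<open>
  Functions on the open unit disc are total functions on \<^typ>\<open>complex\<close>; their values
  outside \<open>ball 0 1\<close> play no role below.
\<close>

definition class_A :: "(complex \<Rightarrow> complex) set" where
  "class_A = {f. f analytic_on ball 0 1 \<and> f 0 = 0 \<and> deriv f 0 = 1}"

definition subordinate :: "(complex \<Rightarrow> complex) \<Rightarrow> (complex \<Rightarrow> complex) \<Rightarrow> bool"
    (infix "\<prec>\<^sub>D" 50) where
  "g \<prec>\<^sub>D \<phi> \<longleftrightarrow>
     (\<exists>\<omega>. \<omega> analytic_on ball 0 1 \<and> \<omega> ` ball 0 1 \<subseteq> ball 0 1 \<and> \<omega> 0 = 0 \<and>
          (\<forall>z\<in>ball 0 1. g z = \<phi> (\<omega> z)))"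

text \<open>The quotient \<open>z f'(z) / f(z)\<close>, with its removable singularity at 0 filled in.\<close>

definition starlike_quotient :: "(complex \<Rightarrow> complex) \<Rightarrow> complex \<Rightarrow> complex" where
  "starlike_quotient f z = (if z = 0 then 1 else z * deriv f z / f z)"

text \<open>
  The condition that \<open>f\<close> has no zeros other than 0 is explicit because division by zero
  is total in HOL. The definition is meant for \<open>\<phi>\<close> analytic on the disc with \<open>\<phi> 0 = 1\<close>.
\<close>

definition S_star :: "(complex \<Rightarrow> complex) \<Rightarrow> (complex \<Rightarrow> complex) set" where
  "S_star \<phi> =
     {f \<in> class_A. (\<forall>z\<in>ball 0 1 - {0}. f z \<noteq> 0) \<and> starlike_quotient f \<prec>\<^sub>D \<phi>}"

definition S_star_radius :: "(complex \<Rightarrow> complex) \<Rightarrow> (complex \<Rightarrow> complex) set \<Rightarrow> real" where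
  "S_star_radius \<phi> F =
     Sup {r \<in> {0<..1}. \<forall>f\<in>F. (\<lambda>z. f (of_real r * z) / of_real r) \<in> S_star \<phi>}"

definition phi_0 :: "complex \<Rightarrow> complex" where
  "phi_0 z = (1 + z) / (1 - z)"

definition phi_3_4 :: "complex \<Rightarrow> complex" where
  "phi_3_4 z = (1 - z / 2) / (1 - z)"

end

theory Submission
  imports Defs
begin

text \<open>
  The image of the disc under \<open>phi_3_4\<close> is the half-plane \<open>Re w > 3/4\<close>. By the Schwarz lemma the
  quotient of \<open>f(rz)/r\<close> is \<open>phi_0 u\<close> with \<open>|u| < r\<close>, and \<open>Re (phi_0 u) > 3/4\<close> as soon as
  \<open>|u| < 1/7\<close>. For the Koebe function the quotient is \<open>phi_0\<close> itself, which takes the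
  excluded value \<open>3/4\<close> at \<open>-1/7\<close>.
\<close>

definition koebe :: "complex \<Rightarrow> complex" where
  "koebe z = z / (1 - z)^2"

lemma deriv_koebe:
  assumes "z \<noteq> 1"
  shows "deriv koebe z = (1 + z) / (1 - z)^3"
proof (rule DERIV_imp_deriv)
  have nz: "1 - z \<noteq> 0"
    using assms by simp
  have eq: "((1 - z)^2 + 2 * z * (1 - z)) / ((1 - z)^2)^2 = (1 + z) / (1 - z)^3"
  proof -
    \<comment> \<open>The quotient-rule numerator factors as \<open>(1 + z) * (1 - z)\<close>, so
      one power of \<open>1 - z\<close> cancels.\<close>
    have "((1 - z)^2 + 2 * z * (1 - z)) / ((1 - z)^2)^2
        = ((1 + z) * (1 - z)) / ((1 - z)^3 * (1 - z))"
      by (simp add: algebra_simps power2_eq_square power3_eq_cube)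
    then show ?thesis
      using nz by simp
  qed
  have "(koebe has_field_derivative ((1 - z)^2 + 2 * z * (1 - z)) / ((1 - z)^2)^2) (at z)"
    unfolding koebe_def[abs_def] using nz
    by (auto intro!: derivative_eq_intros) (simp add: power2_eq_square algebra_simps)
  then show "(koebe has_field_derivative (1 + z) / (1 - z)^3) (at z)"
    unfolding eq .
qed

lemma starlike_quotient_koebe:
  assumes "z \<noteq> 1"
  shows "starlike_quotient koebe z = phi_0 z"
proof -
  \<comment> \<open>This cancellation covers \<open>z \<noteq> 0\<close>; at 0 both sides of the
    claim equal 1.\<close>
  have "z * (p / d^3) / (z / d^2) = p / d" if "z \<noteq> 0" "d \<noteq> 0" for z p d :: complex
    using that by (simp add: power2_eq_square power3_eq_cube)
  from this[of z "1 - z" "1 + z"] show ?thesis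
    using assms by (simp add: starlike_quotient_def phi_0_def deriv_koebe) (simp add: koebe_def)
qed

text \<open>Since the quotient of \<open>koebe\<close> is \<open>phi_0\<close> itself, the identity
  map serves as the subordinating function.\<close>

lemma koebe_in_S_star: "koebe \<in> S_star phi_0"
proof -
  have ne: "z \<noteq> 1" if "z \<in> ball 0 1" for z :: complex
    using that by auto
  have "koebe analytic_on ball 0 1"
    unfolding koebe_def[abs_def] using ne by (auto intro!: analytic_intros)
  moreover have "starlike_quotient koebe \<prec>\<^sub>D phi_0"
    unfolding subordinate_def
    by (rule exI[of _ "\<lambda>z. z"]) (use ne starlike_quotient_koebe in \<open>auto intro: analytic_intros\<close>)
  ultimately show ?thesis
    using ne by (auto simp: S_star_def class_A_def deriv_koebe koebe_def)
qed

lemma deriv_dilation: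
  fixes f :: "complex \<Rightarrow> complex"
  assumes "f analytic_on ball 0 1" "0 < r" "norm (of_real r * z) < 1"
  shows "deriv (\<lambda>z. f (of_real r * z) / of_real r) z = deriv f (of_real r * z)"
proof (rule DERIV_imp_deriv)
  have "(f has_field_derivative deriv f (of_real r * z)) (at (of_real r * z))"
    using assms by (metis analytic_on_imp_differentiable_at DERIV_deriv_iff_field_differentiable
        mem_ball_0)
  from DERIV_chain2[where g = "\<lambda>z. of_real r * z" and x = z and Db = "of_real r", OF this]
  have "((\<lambda>z. f (of_real r * z)) has_field_derivative deriv f (of_real r * z) * of_real r) (at z)"
    by (auto intro!: derivative_eq_intros)
  from DERIV_cdivide[OF this, of "of_real r"]
  show "((\<lambda>z. f (of_real r * z) / of_real r) has_field_derivative deriv f (of_real r * z)) (at z)"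
    using assms by simp
qed

text \<open>The chain-rule factor \<open>r\<close> cancels in the derivative, and the remaining
  \<open>1/r\<close> in the denominator turns the factor \<open>z\<close> into
  \<open>r * z\<close>.\<close>

lemma starlike_quotient_dilation:
  assumes "f analytic_on ball 0 1" "0 < r" "norm (of_real r * z) < 1"
  shows "starlike_quotient (\<lambda>z. f (of_real r * z) / of_real r) z
       = starlike_quotient f (of_real r * z)"
  using assms by (simp add: starlike_quotient_def deriv_dilation)

text \<open>Solving \<open>phi_3_4 w = phi_0 u\<close> for \<open>w\<close> gives
  \<open>w * (1 + 3 * u) = 4 * u\<close>, so this Moebius map is the inverse of
  \<open>phi_3_4\<close> after \<open>phi_0\<close>. Its pole \<open>u = -1/3\<close> is where
  \<open>phi_0\<close> equals 1/2, the value of \<open>phi_3_4\<close> at infinity.\<close>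

lemma phi_0_eq_phi_3_4:
  assumes "u \<noteq> 1" "1 + 3 * u \<noteq> 0"
  shows "phi_0 u = phi_3_4 (4 * u / (1 + 3 * u))"
proof -
  have u: "1 - u \<noteq> 0"
    using assms by simp
  have "1 - 4 * u / (1 + 3 * u) = (1 - u) / (1 + 3 * u)"
    using assms(2) by (simp add: field_simps)
  moreover have "1 - 4 * u / d / 2 = (d - 2 * u) / d" if "d \<noteq> 0" for d
    using that by (simp add: field_simps)
  from this[OF assms(2)] have "1 - 4 * u / (1 + 3 * u) / 2 = (1 + u) / (1 + 3 * u)"
    by simp
  ultimately show ?thesis
    unfolding phi_0_def phi_3_4_def using u assms(2) by simp
qed

lemma dilation_in_class_A:
  assumes f: "f \<in> class_A" and r: "0 < r" "r \<le> 1"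
  shows "(\<lambda>z. f (of_real r * z) / of_real r) \<in> class_A"
proof -
  have "f analytic_on ball 0 1"
    using f by (simp add: class_A_def)
  moreover have "(\<lambda>z. f (of_real r * z)) holomorphic_on ball 0 1"
  proof (rule holomorphic_on_compose_gen[of "\<lambda>z. of_real r * z" _ f "ball 0 1", unfolded o_def])
    show "(\<lambda>z. of_real r * z) holomorphic_on ball 0 1"
      by (intro holomorphic_intros)
    show "f holomorphic_on ball 0 1"
      using \<open>f analytic_on ball 0 1\<close> by (simp add: analytic_on_open)
    show "(\<lambda>z. complex_of_real r * z) ` ball 0 1 \<subseteq> ball 0 1"
    proof (clarsimp simp: norm_mult)
      fix z :: complex
      assume "norm z < 1"
      then have "r * norm z \<le> 1 * norm z"
        using r by (intro mult_right_mono) auto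
      with \<open>norm z < 1\<close> show "\<bar>r\<bar> * norm z < 1"
        using r by simp
    qed
  qed
  ultimately show ?thesis
    using f r by (auto simp: class_A_def deriv_dilation analytic_on_open intro!: holomorphic_intros)
qed

text \<open>The subordinating function is explicit: dilate by \<open>r\<close>, apply the
  \<open>\<omega>\<close> belonging to \<open>f\<close>, then apply
  \<open>4 * u / (1 + 3 * u)\<close>. The last map sends the disc of radius 1/7 into the unit
  disc.\<close>

lemma dilation_in_S_star_phi_3_4:
  assumes f: "f \<in> S_star phi_0" and r: "0 < r" "r \<le> 1 / 7"
  shows "(\<lambda>z. f (of_real r * z) / of_real r) \<in> S_star phi_3_4"
proof -
  have A: "f \<in> class_A" and nz: "\<And>z. norm z < 1 \<Longrightarrow> z \<noteq> 0 \<Longrightarrow> f z \<noteq> 0"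
    using f by (auto simp: S_star_def)
  then have fan: "f analytic_on ball 0 1"
    by (simp add: class_A_def)
  obtain \<omega> where \<omega>: "\<omega> holomorphic_on ball 0 1" "\<And>z. norm z < 1 \<Longrightarrow> norm (\<omega> z) < 1" "\<omega> 0 = 0"
      and q: "\<And>z. norm z < 1 \<Longrightarrow> starlike_quotient f z = phi_0 (\<omega> z)"
    using f by (fastforce simp: S_star_def subordinate_def analytic_on_open)
  have rz: "norm (of_real r * z) < 1 / 7" if "norm z < 1" for z :: complex
  proof -
    have "r * norm z < r * 1"
      using r that by (intro mult_strict_left_mono) auto
    with r have "r * norm z < 1 / 7"
      by linarith
    then show ?thesis
      using r by (simp add: norm_mult)
  qed
  define u where "u z = \<omega> (of_real r * z)" for z
  \<comment> \<open>The Schwarz lemma gives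
    \<open>norm (\<omega> (r * z)) \<le> norm (r * z)\<close>, which is below 1/7.\<close>
  have u: "norm (u z) < 1 / 7" if "norm z < 1" for z
    using Schwarz_Lemma(1)[OF \<omega>(1,3,2), of "of_real r * z"] rz[OF that] by (simp add: u_def)
  \<comment> \<open>The origin of 1/7: the right side is at least \<open>1 - 3 * norm (u z)\<close>,
    and this exceeds \<open>4 * norm (u z)\<close> exactly when \<open>norm (u z) < 1/7\<close>. The
    strict inequality also keeps the denominator \<open>1 + 3 * u z\<close> away from 0.\<close>
  have u4: "norm (4 * u z) < norm (1 + 3 * u z)" if "norm z < 1" for z
    using norm_triangle_ineq2[of 1 "- (3 * u z)"] u[OF that] by (simp add: norm_mult)
  have hol: "u holomorphic_on ball 0 1"
    unfolding u_def
  proof (rule holomorphic_on_compose_gen[of "\<lambda>z. of_real r * z" _ \<omega> "ball 0 1", unfolded o_def])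
    show "(\<lambda>z. of_real r * z) holomorphic_on ball 0 1"
      by (intro holomorphic_intros)
  qed (use \<omega>(1) rz in \<open>fastforce+\<close>)
  have "starlike_quotient (\<lambda>z. f (of_real r * z) / of_real r) \<prec>\<^sub>D phi_3_4"
    unfolding subordinate_def
  proof (intro exI conjI ballI)
    show "(\<lambda>z. 4 * u z / (1 + 3 * u z)) analytic_on ball 0 1"
      unfolding analytic_on_open[OF open_ball]
    proof (intro holomorphic_intros hol)
      fix z :: complex
      assume "z \<in> ball 0 1"
      with u4[of z] show "1 + 3 * u z \<noteq> 0"
        by force
    qed
    show "(\<lambda>z. 4 * u z / (1 + 3 * u z)) ` ball 0 1 \<subseteq> ball 0 1"
    proof (rule image_subsetI)
      fix z :: complex
      assume "z \<in> ball 0 1"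
      then have less: "norm (4 * u z) < norm (1 + 3 * u z)"
        using u4 by simp
      then have "0 < norm (1 + 3 * u z)"
        by (rule le_less_trans[OF norm_ge_zero])
      with less show "4 * u z / (1 + 3 * u z) \<in> ball 0 1"
        by (simp only: mem_ball_0 norm_divide divide_less_eq_1_pos)
    qed
    show "4 * u 0 / (1 + 3 * u 0) = 0"
      using \<omega>(3) by (simp add: u_def)
    fix z :: complex
    assume "z \<in> ball 0 1"
    then have z: "norm z < 1"
      by simp
    have "u z \<noteq> 1" "1 + 3 * u z \<noteq> 0"
      using u[OF z] u4[OF z] by auto
    moreover have z': "norm (of_real r * z) < 1"
      using rz[OF z] by simp
    ultimately show "starlike_quotient (\<lambda>z. f (of_real r * z) / of_real r) z
        = phi_3_4 (4 * u z / (1 + 3 * u z))"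
      using starlike_quotient_dilation[OF fan r(1) z'] q[OF z'] phi_0_eq_phi_3_4[of "u z"]
      by (simp add: u_def)
  qed
  moreover have "f (of_real r * z) / of_real r \<noteq> 0" if "z \<in> ball 0 1 - {0}" for z
    using nz[of "of_real r * z"] rz[of z] r(1) that by auto
  ultimately show ?thesis
    using dilation_in_class_A[OF A r(1)] r(2) by (simp add: S_star_def)
qed

text \<open>The equation is linear in \<open>w\<close> after clearing denominators, and its only
  solution is the boundary point -1.\<close>

lemma phi_3_4_neq_3_4:
  assumes "norm w < 1"
  shows "phi_3_4 w \<noteq> 3 / 4"
proof
  assume eq: "phi_3_4 w = 3 / 4"
  have "1 - w \<noteq> 0"
    using assms by auto
  with eq have "4 * (1 - w / 2) = 3 * (1 - w)"
    by (simp add: phi_3_4_def field_simps)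
  moreover have "w + 1 = 4 * (1 - w / 2) - 3 * (1 - w)"
    by (simp add: algebra_simps)
  ultimately have "w = -1"
    by (simp add: eq_neg_iff_add_eq_0)
  with assms show False
    by simp
qed

text \<open>For \<open>r > 1/7\<close> the disc of radius \<open>r\<close> contains -1/7, where the
  quotient of \<open>koebe\<close> takes the value 3/4 omitted by \<open>phi_3_4\<close>.\<close>

lemma radius_le_of_koebe:
  assumes r: "0 < r" "r \<le> 1"
    and S: "(\<lambda>z. koebe (of_real r * z) / of_real r) \<in> S_star phi_3_4"
  shows "r \<le> 1 / 7"
proof (rule ccontr)
  assume "\<not> r \<le> 1 / 7"
  \<comment> \<open>Chosen so that \<open>r * z = -1/7\<close>; it lies in the unit disc precisely
    because \<open>r > 1/7\<close>.\<close>
  define z :: complex where "z = of_real (- 1 / (7 * r))"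
  have z: "norm z < 1"
    using \<open>\<not> r \<le> 1 / 7\<close> r by (simp only: z_def norm_of_real) (simp add: field_simps)
  have rz: "of_real r * z = - 1 / 7"
    using r by (simp add: z_def)
  have rz1: "norm (of_real r * z) < 1"
    by (simp add: rz)
  from S obtain \<omega> where "\<omega> ` ball 0 1 \<subseteq> ball 0 1"
    and "\<forall>z\<in>ball 0 1. starlike_quotient (\<lambda>z. koebe (of_real r * z) / of_real r) z = phi_3_4 (\<omega> z)"
    unfolding S_star_def subordinate_def by blast
  with z have w: "norm (\<omega> z) < 1"
    and "starlike_quotient (\<lambda>z. koebe (of_real r * z) / of_real r) z = phi_3_4 (\<omega> z)"
    by (auto simp: image_subset_iff)
  moreover have "starlike_quotient (\<lambda>z. koebe (of_real r * z) / of_real r) z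
      = starlike_quotient koebe (of_real r * z)"
    using koebe_in_S_star r(1) rz1
    by (intro starlike_quotient_dilation) (auto simp: S_star_def class_A_def)
  moreover have "starlike_quotient koebe (of_real r * z) = 3 / 4"
  proof (subst starlike_quotient_koebe)
    show "of_real r * z \<noteq> 1"
      using rz1 by auto
    show "phi_0 (of_real r * z) = 3 / 4"
      by (simp add: rz phi_0_def)
  qed
  ultimately show False
    using phi_3_4_neq_3_4[OF w] by simp
qed

theorem theorem7p17:
  shows "S_star_radius phi_3_4 (S_star phi_0) = 1 / 7"
  unfolding S_star_radius_def
\<comment> \<open>The supremum is attained: 1/7 is itself admissible, and the single function
  \<open>koebe\<close> bounds every admissible \<open>r\<close>.\<close>
proof (rule cSup_eq_maximum)
  show "1 / 7 \<in> {r \<in> {0<..1}. \<forall>f\<in>S_star phi_0.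
      (\<lambda>z. f (complex_of_real r * z) / complex_of_real r) \<in> S_star phi_3_4}"
    using dilation_in_S_star_phi_3_4[of _ "1 / 7"] by simp
qed (use radius_le_of_koebe koebe_in_S_star in auto)

end
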